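(* Let $f\colon [0,\infty)\to (0,\infty)$ be a non-decreasing function such that $\sum_{n=1}^{\infty} \frac{1}{f(2^n)}=\infty$. Let $0<r<2\leq p$ and let $q=2(p-r)/(2-r)$. Then there is a martingale difference sequence $\{X_n\}_{n\geq 1}$ such that $\sup_{n\geq 1} \mathbb{E}(|X_n|^q f(|X_n|))<\infty$ and $$\sum_{n=1}^{\infty} n^{p/r-2}\, \mathbb{P}(|S_n|>n^{1/r})=\infty.$$
   Context: All random variables are real-valued and those in a sequence $\{X_n\}_{n\geq 1}$ are defined on the same probability space $(\Omega,\mathcal{F},\mathbb{P})$. For $n\geq 1$ let $S_n=\sum_{i=1}^n X_i$. $\{X_n\}_{n\geq 1}$ is a martingale difference sequence if there is a filtration $\{\mathcal{F}_n\}_{n\geq 0}$ such that $\mathcal{F}_0=\{\emptyset,\Omega\}$, $X_n$ is (integrable and) $\mathcal{F}_n$-measurable, and $\mathbb{E}(X_n\,|\,\mathcal{F}_{n-1})=0$ for all $n\geq 1$. *)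

theory Defs
  imports "HOL-Probability.Probability"
begin

(* The sequence is X 1, X 2, ...; the value X 0 is not used.  The conditional expectation is
   defined only up to null sets, so E(X n | F (n - 1)) = 0 is an almost sure equality. *)
definition martingale_difference_sequence ::
    "'a measure \<Rightarrow> (nat \<Rightarrow> 'a \<Rightarrow> real) \<Rightarrow> bool" where
  "martingale_difference_sequence M X \<longleftrightarrow>
    (\<exists>F :: nat \<Rightarrow> 'a measure.
       filtration (space M) F \<and>
       (\<forall>n. subalgebra M (F n)) \<and>
       sets (F 0) = {{}, space M} \<and>
       (\<forall>n\<ge>1. integrable M (X n) \<and>
              X n \<in> borel_measurable (F n) \<and>
              (AE \<omega> in M. real_cond_exp M (F (n - 1)) (X n) \<omega> = 0)))"

end

(* Take a random level k, with probability proportional to 1 / (a_k^q f(a_k)), and let X_n be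
   independent signs times a_k for 4^k < n <= 4^(k+1) and zero for all other n.  Each X_n lives on
   a single level, so its moment is bounded uniformly in n.  With a_k of order 4^(k(1/r - 1/2)), the
   sum of at least 4^k signs on level k exceeds n^(1/r) with probability at least 1/6
   (Paley-Zygmund).  Since a_k^q is of order 4^(k(p/r - 1)), level k contributes at least a
   constant times 1/f(a_k) to the series, and by condensation the sum of these diverges.

   The points of the probability space are the paths n |-> X_n themselves; their law is discrete
   and invariant under changing the sign of any single coordinate, which gives both the martingale
   property and the vanishing of the odd mixed moments. *)
theory Submission
  imports Defs
begin

text \<open>The default value 0 makes the points whole paths that vanish off \<open>B\<close>. For
  finite \<open>B\<close> the uniform law on them is that of independent signs times
  \<open>a\<close> on \<open>B\<close> and zero elsewhere.\<close>

definition sign_cube :: "nat set \<Rightarrow> real \<Rightarrow> (nat \<Rightarrow> real) set" where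
  "sign_cube B a = PiE_dflt B 0 (\<lambda>_. {- a, a})"

definition flip :: "nat \<Rightarrow> (nat \<Rightarrow> real) \<Rightarrow> nat \<Rightarrow> real" where
  "flip n \<omega> = fun_upd \<omega> n (- \<omega> n)"

lemma finite_sign_cube: "finite B \<Longrightarrow> finite (sign_cube B a)"
  unfolding sign_cube_def by (rule finite_PiE_dflt) auto

lemma sign_cube_nonempty: "sign_cube B a \<noteq> {}"
  by (auto simp: sign_cube_def PiE_dflt_def split: if_splits
      intro!: exI[of _ "\<lambda>i. if i \<in> B then a else 0"])

text \<open>\<open>flip n\<close> is an involution that maps the cube into itself; when
  \<open>n\<close> lies outside \<open>B\<close> it fixes every point of the cube, since the
  coordinate there is 0.\<close>

lemma map_pmf_flip_sign_cube:
  assumes "finite B"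
  shows "map_pmf (flip n) (pmf_of_set (sign_cube B a)) = pmf_of_set (sign_cube B a)"
proof (rule map_pmf_of_set_bij_betw)
  have "flip n ` sign_cube B a \<subseteq> sign_cube B a"
    unfolding flip_def sign_cube_def PiE_dflt_def by fastforce
  then show "bij_betw (flip n) (sign_cube B a) (sign_cube B a)"
    by (intro bij_betw_byWitness[where f' = "flip n"]) (auto simp: flip_def)
qed (use assms in \<open>auto simp: sign_cube_nonempty finite_sign_cube\<close>)

text \<open>Transporting the integral along the flip turns it into its own negative.\<close>

lemma expectation_odd:
  fixes g :: "(nat \<Rightarrow> real) \<Rightarrow> real"
  assumes P: "map_pmf (flip n) P = P" and g: "\<And>\<omega>. g (flip n \<omega>) = - g \<omega>"
  shows "measure_pmf.expectation P g = 0"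
proof -
  have "measure_pmf.expectation P g = measure_pmf.expectation (map_pmf (flip n) P) g"
    by (simp add: P)
  also have "\<dots> = - measure_pmf.expectation P g"
    by (simp add: g)
  finally show ?thesis by simp
qed

text \<open>Coordinates are added one at a time. The square of the new coordinate is the constant
  a^2, and terms odd in it average to zero because flipping it leaves the remaining sum unchanged.
  The factor 3, as for a Gaussian variable, is preserved by the induction.\<close>

lemma sign_cube_moments:
  fixes a :: real
  assumes B: "finite B" and D: "D \<subseteq> B"
  defines "P \<equiv> pmf_of_set (sign_cube B a)"
  shows "measure_pmf.expectation P (\<lambda>\<omega>. (\<Sum>i\<in>D. \<omega> i)\<^sup>2) = card D * a\<^sup>2"
    and "measure_pmf.expectation P (\<lambda>\<omega>. (\<Sum>i\<in>D. \<omega> i) ^ 4) \<le> 3 * (card D * a\<^sup>2)\<^sup>2"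
proof -
  have setP: "set_pmf P = sign_cube B a"
    unfolding P_def by (simp add: B sign_cube_nonempty finite_sign_cube)
  have int [simp]: "integrable P g" for g :: "(nat \<Rightarrow> real) \<Rightarrow> real"
    by (rule integrable_measure_pmf_finite) (simp add: setP finite_sign_cube B)
  have flipP: "map_pmf (flip n) P = P" for n
    unfolding P_def by (rule map_pmf_flip_sign_cube[OF B])
  have "finite D" using D B by (rule finite_subset)
  then have "measure_pmf.expectation P (\<lambda>\<omega>. (\<Sum>i\<in>D. \<omega> i)\<^sup>2) = card D * a\<^sup>2 \<and>
    measure_pmf.expectation P (\<lambda>\<omega>. (\<Sum>i\<in>D. \<omega> i) ^ 4) \<le> 3 * (card D * a\<^sup>2)\<^sup>2"
    using D
  proof (induction D rule: finite_induct)
    case empty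
    then show ?case by simp
  next
    case (insert x D)
    let ?R = "\<lambda>\<omega>. \<Sum>i\<in>D. \<omega> i :: real" and ?E = "measure_pmf.expectation P"
    have x: "x \<in> B" "x \<notin> D" using insert by auto
    have sq: "AE \<omega> in P. (\<omega> x)\<^sup>2 = a\<^sup>2"
      using x by (auto simp: AE_measure_pmf_iff setP sign_cube_def PiE_dflt_def)
    have R: "?R (flip x \<omega>) = ?R \<omega>" for \<omega>
      using x(2) by (intro sum.cong) (auto simp: flip_def)
    \<comment> \<open>Used with exponents 1 and 3; the explicit \<open>^ 1\<close> in the expansions
      below keeps the terms in the form of this fact.\<close>
    have odd: "?E (\<lambda>\<omega>. ?R \<omega> ^ j * \<omega> x) = 0" for j
      by (rule expectation_odd[OF flipP[of x]]) (unfold R, simp add: flip_def)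
    have "?E (\<lambda>\<omega>. (\<Sum>i\<in>insert x D. \<omega> i)\<^sup>2) = ?E (\<lambda>\<omega>. (?R \<omega>)\<^sup>2 + 2 * (?R \<omega> ^ 1 * \<omega> x) + a\<^sup>2)"
      using sq insert.hyps by (intro integral_cong_AE) (auto simp: power2_eq_square algebra_simps)
    also have "\<dots> = ?E (\<lambda>\<omega>. (?R \<omega>)\<^sup>2) + 2 * ?E (\<lambda>\<omega>. ?R \<omega> ^ 1 * \<omega> x) + a\<^sup>2"
      by simp
    also have "\<dots> = card (insert x D) * a\<^sup>2"
      using insert unfolding odd by (simp add: algebra_simps)
    finally have two: "?E (\<lambda>\<omega>. (\<Sum>i\<in>insert x D. \<omega> i)\<^sup>2) = card (insert x D) * a\<^sup>2" .
    have expand: "(y + s) ^ 4 = s ^ 4 + 4 * (s ^ 3 * y) + 6 * a\<^sup>2 * s\<^sup>2 + 4 * a\<^sup>2 * (s ^ 1 * y) + a ^ 4"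
      if "y\<^sup>2 = a\<^sup>2" for y s :: real
    proof -
      have "(y + s) ^ 4 = s ^ 4 + 4 * (s ^ 3 * y) + 6 * y\<^sup>2 * s\<^sup>2 + 4 * y\<^sup>2 * (s ^ 1 * y) + (y\<^sup>2)\<^sup>2"
        by algebra
      then show ?thesis unfolding that by simp
    qed
    have "?E (\<lambda>\<omega>. (\<Sum>i\<in>insert x D. \<omega> i) ^ 4) =
        ?E (\<lambda>\<omega>. ?R \<omega> ^ 4 + 4 * (?R \<omega> ^ 3 * \<omega> x) + 6 * a\<^sup>2 * (?R \<omega>)\<^sup>2 + 4 * a\<^sup>2 * (?R \<omega> ^ 1 * \<omega> x) + a ^ 4)"
      using sq insert.hyps by (intro integral_cong_AE) (auto simp: expand simp del: power_one_right)
    also have "\<dots> = ?E (\<lambda>\<omega>. ?R \<omega> ^ 4) + 4 * ?E (\<lambda>\<omega>. ?R \<omega> ^ 3 * \<omega> x) + 6 * a\<^sup>2 * ?E (\<lambda>\<omega>. (?R \<omega>)\<^sup>2)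
        + 4 * a\<^sup>2 * ?E (\<lambda>\<omega>. ?R \<omega> ^ 1 * \<omega> x) + a ^ 4"
      by simp
    also have "\<dots> \<le> 3 * (card D * a\<^sup>2)\<^sup>2 + 6 * a\<^sup>2 * (card D * a\<^sup>2) + a ^ 4"
      using insert unfolding odd by simp
    \<comment> \<open>Raising the coefficient of a^4 from 1 to 3 completes the square 3 * (card D *
      a^2 + a^2)^2.\<close>
    also have "\<dots> \<le> 3 * (card D * a\<^sup>2)\<^sup>2 + 6 * a\<^sup>2 * (card D * a\<^sup>2) + 3 * a ^ 4"
      by simp
    also have "\<dots> = 3 * (card (insert x D) * a\<^sup>2)\<^sup>2"
      using insert.hyps by (simp add: algebra_simps power2_eq_square power4_eq_xxxx)
    finally show ?case using two by blast
  qed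
  then show "measure_pmf.expectation P (\<lambda>\<omega>. (\<Sum>i\<in>D. \<omega> i)\<^sup>2) = card D * a\<^sup>2"
    "measure_pmf.expectation P (\<lambda>\<omega>. (\<Sum>i\<in>D. \<omega> i) ^ 4) \<le> 3 * (card D * a\<^sup>2)\<^sup>2"
    by blast+
qed

text \<open>The squared sum divided by its mean has mean 1 and second moment at most 3, so it cannot
  be concentrated near zero. The bound 1/6 arises as 2/3 * (1 - 1/4 - 3/6).\<close>

lemma sign_cube_anticoncentration:
  fixes a :: real
  assumes B: "finite B" and D: "D \<subseteq> B" "D \<noteq> {}" and a: "a \<noteq> 0"
  shows "measure (measure_pmf (pmf_of_set (sign_cube B a)))
    {\<omega>. (\<Sum>i\<in>D. \<omega> i)\<^sup>2 > real (card D) * a\<^sup>2 / 4} \<ge> 1 / 6"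
proof -
  let ?P = "pmf_of_set (sign_cube B a)" and ?v = "real (card D) * a\<^sup>2"
  let ?A = "{\<omega>. (\<Sum>i\<in>D. \<omega> i :: real)\<^sup>2 > ?v / 4}"
  define Z where "Z \<omega> = (\<Sum>i\<in>D. \<omega> i)\<^sup>2 / ?v" for \<omega>
  have card_D: "card D > 0"
    using D finite_subset[OF D(1) B] by (simp add: card_gt_0_iff)
  then have v: "?v > 0"
    using a by simp
  have int [simp]: "integrable ?P g" for g :: "(nat \<Rightarrow> real) \<Rightarrow> real"
    by (rule integrable_measure_pmf_finite) (simp add: finite_sign_cube sign_cube_nonempty B)
  have Z1: "measure_pmf.expectation ?P Z = 1"
    unfolding Z_def using sign_cube_moments(1)[OF B D(1), of a] a card_D by simp
  have "measure_pmf.expectation ?P (\<lambda>\<omega>. (Z \<omega>)\<^sup>2)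
      = measure_pmf.expectation ?P (\<lambda>\<omega>. (\<Sum>i\<in>D. \<omega> i) ^ 4) / ?v\<^sup>2"
    unfolding Z_def by (simp add: power_divide flip: power_mult)
  also have "\<dots> \<le> 3"
    using sign_cube_moments(2)[OF B D(1), of a]
    by (simp only: pos_divide_le_eq[OF zero_less_power[OF v]])
  finally have Z2: "measure_pmf.expectation ?P (\<lambda>\<omega>. (Z \<omega>)\<^sup>2) \<le> 3" .
  \<comment> \<open>Paley-Zygmund without Cauchy-Schwarz: a parabola lies below the indicator of \<open>Z > 1 / 4\<close>.\<close>
  have "1 / 6 \<le> 2 / 3 * (measure_pmf.expectation ?P Z - 1 / 4
      - measure_pmf.expectation ?P (\<lambda>\<omega>. (Z \<omega>)\<^sup>2) / 6)"
    using Z1 Z2 by simp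
  also have "\<dots> = measure_pmf.expectation ?P (\<lambda>\<omega>. 2 / 3 * (Z \<omega> - 1 / 4 - (Z \<omega>)\<^sup>2 / 6))"
    by simp
  also have "\<dots> \<le> measure_pmf.expectation ?P (indicator ?A)"
  proof (rule integral_mono)
    fix \<omega> :: "nat \<Rightarrow> real"
    \<comment> \<open>The parabola peaks at \<open>Z \<omega> = 3\<close>, where its value is
      5/6.\<close>
    have "0 \<le> (Z \<omega> - 3)\<^sup>2" by simp
    then have "2 / 3 * (Z \<omega> - 1 / 4 - (Z \<omega>)\<^sup>2 / 6) \<le> 1"
      by (simp add: power2_eq_square algebra_simps)
    moreover have "2 / 3 * (Z \<omega> - 1 / 4 - (Z \<omega>)\<^sup>2 / 6) \<le> 0" if "Z \<omega> \<le> 1 / 4"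
    proof (rule mult_nonneg_nonpos)
      have "0 \<le> (Z \<omega>)\<^sup>2 / 6" by simp
      then show "Z \<omega> - 1 / 4 - (Z \<omega>)\<^sup>2 / 6 \<le> 0" using that by linarith
    qed simp
    moreover have "\<omega> \<in> ?A \<longleftrightarrow> Z \<omega> > 1 / 4"
      using v by (simp add: Z_def pos_less_divide_eq)
    ultimately show "2 / 3 * (Z \<omega> - 1 / 4 - (Z \<omega>)\<^sup>2 / 6) \<le> indicator ?A \<omega>"
      by (cases "Z \<omega> \<le> 1/4") (auto simp: indicator_def)
  qed auto
  finally show ?thesis by simp
qed

text \<open>Cut the series into blocks of length \<open>L\<close>: by monotonicity each block is at
  most \<open>L\<close> times its first term, which is a term of the subsample.\<close>

lemma summable_of_summable_subsample:
  fixes g :: "nat \<Rightarrow> real"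
  assumes nonneg: "\<And>n. g n \<ge> 0" and anti: "antimono g" and L: "L > 0"
    and sm: "summable (\<lambda>k. g (k * L))"
  shows "summable g"
proof (rule summableI_nonneg_bounded[OF nonneg])
  fix N
  have "sum g {..<N} \<le> sum g {..<N * L}"
    using L nonneg by (intro sum_mono2) (auto intro: less_le_trans)
  also have "\<dots> = (\<Sum>k<N. sum g {k * L..<k * L + L})"
    by (rule sum.nat_group[symmetric])
  also have "\<dots> \<le> (\<Sum>k<N. L * g (k * L))"
  proof (rule sum_mono)
    fix k
    have "sum g {k * L..<k * L + L} \<le> of_nat (card {k * L..<k * L + L}) * g (k * L)"
      by (rule sum_bounded_above) (auto intro!: antimonoD[OF anti])
    then show "sum g {k * L..<k * L + L} \<le> L * g (k * L)" by simp
  qed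
  also have "\<dots> \<le> L * (\<Sum>k. g (k * L))"
    unfolding sum_distrib_left[symmetric]
    by (intro mult_left_mono sum_le_suminf sm) (auto intro: nonneg)
  finally show "sum g {..<N} \<le> L * (\<Sum>k. g (k * L))" .
qed


text \<open>Flipping coordinate \<open>n\<close> preserves the law and every event of the first
  \<open>n - 1\<close> coordinates, but negates coordinate \<open>n\<close>. Hence the integral of
  that coordinate over each such event vanishes, which characterizes conditional expectation
  zero.\<close>

lemma martingale_difference_sequence_flip_invariant:
  fixes P :: "(nat \<Rightarrow> real) pmf"
  assumes flip: "\<And>n. map_pmf (flip n) P = P"
    and int: "\<And>n. integrable P (\<lambda>\<omega>. \<omega> n)"
  shows "martingale_difference_sequence (measure_pmf P) (\<lambda>n \<omega>. \<omega> n)"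
proof -
  \<comment> \<open>The events determined by the first \<open>n\<close> coordinates already form a sigma algebra.  Coordinate 0 is
     left out, so that \<open>past 0\<close> is trivial.\<close>
  define past :: "nat \<Rightarrow> (nat \<Rightarrow> real) set set" where
    "past n = {A. \<forall>\<omega> \<omega>'. (\<forall>i\<in>{1..n}. \<omega> i = \<omega>' i) \<longrightarrow> (\<omega> \<in> A \<longleftrightarrow> \<omega>' \<in> A)}" for n
  have pastD: "\<omega> \<in> A \<longleftrightarrow> \<omega>' \<in> A"
    if "A \<in> past n" "\<And>i. i \<in> {1..n} \<Longrightarrow> \<omega> i = \<omega>' i" for A n \<omega> \<omega>'
    using that unfolding past_def by blast
  have pastI: "A \<in> past n"
    if "\<And>\<omega> \<omega>'. (\<And>i. i \<in> {1..n} \<Longrightarrow> \<omega> i = \<omega>' i) \<Longrightarrow> \<omega> \<in> A \<longleftrightarrow> \<omega>' \<in> A" for A n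
    unfolding past_def using that by blast
  define F where "F n = sigma UNIV (past n)" for n
  have "sigma_algebra UNIV (past n)" for n
  proof (unfold sigma_algebra_iff2, intro conjI ballI allI impI)
    fix A and B :: "nat \<Rightarrow> (nat \<Rightarrow> real) set"
    show "UNIV - A \<in> past n" if "A \<in> past n"
      using that unfolding past_def by blast
    show "(\<Union>i. B i) \<in> past n" if "range B \<subseteq> past n"
    proof (rule pastI)
      fix \<omega> \<omega>' :: "nat \<Rightarrow> real" assume eq: "\<And>i. i \<in> {1..n} \<Longrightarrow> \<omega> i = \<omega>' i"
      have "\<omega> \<in> B j \<longleftrightarrow> \<omega>' \<in> B j" for j
        using that eq by (intro pastD[of "B j"]) auto
      then show "\<omega> \<in> (\<Union>i. B i) \<longleftrightarrow> \<omega>' \<in> (\<Union>i. B i)" by blast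
    qed
  qed (auto intro: pastI)
  then have sets_F: "sets (F n) = past n" and space_F: "space (F n) = UNIV" for n
    unfolding F_def by (simp_all add: sigma_algebra.sigma_sets_eq)
  have sub: "subalgebra (measure_pmf P) (F n)" for n
    by (simp add: subalgebra_def space_F)
  have "filtration UNIV F"
  proof
    fix i j :: nat
    show "sets (F i) \<subseteq> sets (F j)" if "i \<le> j"
      unfolding sets_F
    proof
      fix A assume A: "A \<in> past i"
      show "A \<in> past j"
        by (rule pastI, rule pastD[OF A]) (use that in simp)
    qed
  qed (rule space_F)
  moreover have "past 0 = {{}, UNIV}"
  proof -
    have "A = {} \<or> A = UNIV" if "A \<in> past 0" for A
    proof -
      have "\<omega> \<in> A \<longleftrightarrow> \<omega>' \<in> A" for \<omega> \<omega>'
        by (rule pastD[OF that]) simp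
      then show ?thesis by blast
    qed
    then show ?thesis by (auto intro: pastI)
  qed
  moreover have "(\<lambda>\<omega>. \<omega> n) \<in> borel_measurable (F n)" if "n \<ge> 1" for n
    using that by (intro measurableI) (auto simp: sets_F space_F intro!: pastI)
  moreover have "AE \<omega> in P. real_cond_exp P (F (n - 1)) (\<lambda>\<omega>. \<omega> n) \<omega> = 0" if n: "n \<ge> 1" for n
  proof -
    interpret finite_measure_subalgebra "measure_pmf P" "F (n - 1)"
      using sub measure_pmf.finite_measure_axioms
      by (simp add: finite_measure_subalgebra_def finite_measure_subalgebra_axioms_def)
    show ?thesis
    proof (rule real_cond_exp_charact)
      fix A assume "A \<in> sets (F (n - 1))"
      then have "A \<in> past (n - 1)" by (simp add: sets_F)
      then have A: "flip n \<omega> \<in> A \<longleftrightarrow> \<omega> \<in> A" for \<omega>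
        by (rule pastD) (use n in \<open>auto simp: flip_def\<close>)
      have "measure_pmf.expectation P (\<lambda>\<omega>. indicator A \<omega> *\<^sub>R \<omega> n) = 0"
        by (rule expectation_odd[OF flip[of n]]) (simp add: indicator_def A, simp add: flip_def)
      then show "(\<integral>\<omega>\<in>A. \<omega> n \<partial>P) = (\<integral>\<omega>\<in>A. 0 \<partial>P)"
        by (simp add: set_lebesgue_integral_def)
    qed (auto simp: int)
  qed
  ultimately show ?thesis
    unfolding martingale_difference_sequence_def using sub int
    by (intro exI[of _ F]) (auto simp: sets_F)
qed

text \<open>Only component \<open>k\<close> of the mixture is kept. This transfers a lower bound on
  one level to the mixture.\<close>

lemma pmf_mult_measure_le_measure_bind_pmf:
  "pmf K k * measure (measure_pmf (Q k)) A \<le> measure (measure_pmf (bind_pmf K Q)) A"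
proof -
  have "ennreal (pmf K k * measure (measure_pmf (Q k)) A)
      = (\<integral>\<^sup>+x. emeasure (Q k) A * indicator {k} x \<partial>K)"
    by (subst nn_integral_cmult)
      (simp_all add: measure_pmf_single measure_pmf.emeasure_eq_measure ennreal_mult' mult.commute)
  also have "\<dots> \<le> emeasure (bind_pmf K Q) A"
    unfolding emeasure_bind_pmf by (intro nn_integral_mono) (simp split: split_indicator)
  finally show ?thesis
    by (simp add: measure_pmf.emeasure_eq_measure del: emeasure_bind_pmf)
qed

text \<open>On every level other than \<open>k0\<close> the coordinate is 0, where \<open>g\<close>
  vanishes; on level \<open>k0\<close> it can only be plus or minus \<open>a k0\<close> or 0, and
  \<open>g\<close> is even. If \<open>n\<close> lies in no block, then \<open>k0\<close> is
  arbitrary and the left side is 0.\<close>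

lemma nn_integral_coordinate_sign_cube_mixture:
  fixes g :: "real \<Rightarrow> ennreal"
  assumes B: "\<And>k. finite (B k)" and k0: "\<And>k. n \<in> B k \<Longrightarrow> k = k0"
    and g: "g 0 = 0" "\<And>x. g (- x) = g x"
  shows "(\<integral>\<^sup>+\<omega>. g (\<omega> n) \<partial>bind_pmf K (\<lambda>k. pmf_of_set (sign_cube (B k) (a k))))
    \<le> g (a k0) * pmf K k0"
proof -
  have "(\<integral>\<^sup>+\<omega>. g (\<omega> n) \<partial>pmf_of_set (sign_cube (B k) (a k))) \<le> g (a k0) * indicator {k0} k" for k
  proof -
    have "AE \<omega> in pmf_of_set (sign_cube (B k) (a k)). g (\<omega> n) \<le> g (a k0) * indicator {k0} k"
    proof (rule AE_pmfI)
      fix \<omega> assume "\<omega> \<in> set_pmf (pmf_of_set (sign_cube (B k) (a k)))"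
      then have "\<omega> \<in> sign_cube (B k) (a k)"
        using B by (simp add: sign_cube_nonempty finite_sign_cube)
      then have "n \<in> B k \<Longrightarrow> \<omega> n = - a k \<or> \<omega> n = a k" "n \<notin> B k \<Longrightarrow> \<omega> n = 0"
        by (auto simp: sign_cube_def PiE_dflt_def)
      then show "g (\<omega> n) \<le> g (a k0) * indicator {k0} k"
        using k0[of k] g by (cases "n \<in> B k") auto
    qed
    then have "(\<integral>\<^sup>+\<omega>. g (\<omega> n) \<partial>pmf_of_set (sign_cube (B k) (a k)))
        \<le> (\<integral>\<^sup>+\<omega>. g (a k0) * indicator {k0} k \<partial>pmf_of_set (sign_cube (B k) (a k)))"
      by (rule nn_integral_mono_AE)
    then show ?thesis by simp
  qed
  then have "(\<integral>\<^sup>+\<omega>. g (\<omega> n) \<partial>bind_pmf K (\<lambda>k. pmf_of_set (sign_cube (B k) (a k))))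
      \<le> (\<integral>\<^sup>+k. g (a k0) * indicator {k0} k \<partial>K)"
    unfolding nn_integral_bind_pmf by (intro nn_integral_mono)
  then show ?thesis
    by (simp add: nn_integral_cmult emeasure_pmf_single)
qed

text \<open>A geometric sequence is dominated by powers of a large \<open>2 ^ m\<close>. Since
  \<open>f\<close> is monotone, summability along it would pass to \<open>1 / f (2 ^ n)\<close>
  along multiples of \<open>m\<close>, and then to all \<open>n\<close>.\<close>

lemma not_summable_inverse_geometric:
  fixes f :: "real \<Rightarrow> real"
  assumes f_pos: "\<And>x. x \<ge> 0 \<Longrightarrow> f x > 0"
    and f_mono: "mono_on {0..} f"
    and f_div: "(\<Sum>n. ennreal (1 / f (2 ^ Suc n))) = \<infinity>"
    and C: "C > 0" and \<sigma>: "\<sigma> > 0"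
  shows "\<not> summable (\<lambda>k. 1 / f (C * \<sigma> ^ k))"
proof
  assume sm: "summable (\<lambda>k. 1 / f (C * \<sigma> ^ k))"
  \<comment> \<open>The 1 in the maximum forces \<open>m > 0\<close>, so that the multiples of
    \<open>m\<close> form a genuine subsample.\<close>
  obtain m :: nat where m: "max 1 (max C \<sigma>) < 2 ^ m"
    using real_arch_pow[of 2 "max 1 (max C \<sigma>)"] by auto
  define g where "g n = 1 / f (2 ^ n)" for n :: nat
  have fle: "1 / f y \<le> 1 / f x" if "0 \<le> x" "x \<le> y" for x y
    using that f_pos[of x] mono_onD[OF f_mono, of x y] by (intro divide_left_mono) auto
  have "m > 0" using m by (cases m) auto
  have "summable (\<lambda>k. g (Suc k * m))"
  proof (rule summable_comparison_test'[OF sm])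
    fix k :: nat
    have "C * \<sigma> ^ k \<le> 2 ^ m * (2 ^ m) ^ k"
      using m C \<sigma> by (intro mult_mono power_mono) auto
    also have "\<dots> = 2 ^ (Suc k * m)"
      by (simp add: power_add mult.commute flip: power_mult)
    finally show "norm (g (Suc k * m)) \<le> 1 / f (C * \<sigma> ^ k)"
      unfolding g_def using fle[of "C * \<sigma> ^ k" "2 ^ (Suc k * m)"] C \<sigma> f_pos[of "2 ^ (Suc k * m)"]
      by simp
  qed
  then have "summable (\<lambda>k. g (k * m))"
    by (subst (asm) summable_Suc_iff)
  moreover have "antimono g"
    unfolding g_def by (intro antimonoI fle power_increasing) auto
  moreover have "g n \<ge> 0" for n
    using f_pos[of "2 ^ n"] by (simp add: g_def)
  ultimately have "summable g"
    using \<open>m > 0\<close> summable_of_summable_subsample by blast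
  then have "summable (\<lambda>n. g (Suc n))"
    by (subst summable_Suc_iff)
  then have "(\<Sum>n. ennreal (g (Suc n))) = ennreal (\<Sum>n. g (Suc n))"
    using f_pos by (intro suminf_ennreal2) (auto simp: g_def less_imp_le)
  then show False using f_div by (simp add: g_def)
qed

theorem theorem5p4:
  fixes f :: "real \<Rightarrow> real" and p q r :: real
  assumes f_pos: "\<And>x. x \<ge> 0 \<Longrightarrow> f x > 0"
    and f_mono: "mono_on {0..} f"
    and f_div: "(\<Sum>n. ennreal (1 / f (2 ^ Suc n))) = \<infinity>"
    and r: "0 < r" "r < 2"
    and p: "2 \<le> p"
    and q: "q = 2 * (p - r) / (2 - r)"
  shows "\<exists>(M :: (nat \<Rightarrow> real) measure) (X :: nat \<Rightarrow> (nat \<Rightarrow> real) \<Rightarrow> real).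
    prob_space M \<and>
    martingale_difference_sequence M X \<and>
    (SUP n\<in>{1..}. \<integral>\<^sup>+ \<omega>. ennreal (\<bar>X n \<omega>\<bar> powr q * f \<bar>X n \<omega>\<bar>) \<partial>M) < \<infinity> \<and>
    (\<Sum>n. ennreal (real (Suc n) powr (p / r - 2) *
        \<P>(\<omega> in M. \<bar>\<Sum>i=1..Suc n. X i \<omega>\<bar> > real (Suc n) powr (1 / r)))) = \<infinity>"
proof -

  \<comment> \<open>Constants and growth rates\<close>
  define \<rho> where "\<rho> = 4 powr (p / r - 1)"
  define \<sigma> where "\<sigma> = 4 powr (1 / r - 1 / 2)"
  \<comment> \<open>In \<open>C\<close>, the factor 4 powr (1/r) pays for N reaching
    \<open>4 ^ Suc k\<close> instead of \<open>4 ^ k\<close>, and the factor 2 cancels the 1/4 in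
    the anticoncentration threshold.\<close>
  define C where "C = 2 * 4 powr (1 / r)"
  define a where "a k = C * \<sigma> ^ k" for k :: nat
  define B where "B k = {4 ^ k<..(4 :: nat) ^ Suc k}" for k
  define w where "w k = 1 / (a k powr q * f (a k))" for k
  have \<rho>_gt1: "\<rho> > 1" unfolding \<rho>_def using p r by simp
  have \<sigma>_pos: "\<sigma> > 0" and C_pos: "C > 0" by (simp_all add: \<sigma>_def C_def)
  have a_pos: "a k > 0" for k using \<sigma>_pos C_pos by (simp add: a_def)
  have fa_pos: "f (a k) > 0" for k using a_pos[of k] by (intro f_pos) simp
  have w_pos: "w k > 0" for k unfolding w_def using a_pos[of k] fa_pos[of k] by simp
  \<comment> \<open>The value of \<open>q\<close> is the one for which
    \<open>\<sigma> powr q = \<rho>\<close>.\<close>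
  have exponent: "(1 / r - 1 / 2) * q = p / r - 1"
  proof -
    have "(1 / r - 1 / 2) * q = (q * (2 - r)) / (2 * r)"
      using r by (simp add: field_simps)
    also have "q * (2 - r) = 2 * (p - r)"
      using r by (simp add: q)
    finally show ?thesis
      using r by (simp add: diff_divide_distrib)
  qed
  have \<sigma>_pow: "\<sigma> ^ k = 4 powr ((1 / r - 1 / 2) * k)" for k
    by (simp add: \<sigma>_def powr_powr flip: powr_realpow)
  have a_powr: "a k powr q = C powr q * \<rho> ^ k" for k
  proof -
    have "\<rho> ^ k = 4 powr ((1 / r - 1 / 2) * q * k)"
      unfolding exponent by (simp add: \<rho>_def powr_powr flip: powr_realpow)
    then show ?thesis
      unfolding a_def \<sigma>_pow using C_pos by (simp add: powr_mult powr_powr mult_ac)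
  qed

  \<comment> \<open>Law of the random level\<close>
  have w_summable: "summable w"
  proof (rule summable_comparison_test')
    show "summable (\<lambda>k. 1 / (C powr q * f 0) * (1 / \<rho>) ^ k)"
      using \<rho>_gt1 by (intro summable_mult summable_geometric) simp
    fix k
    \<comment> \<open>Replacing \<open>f (a k)\<close> by the smaller \<open>f 0\<close> leaves a
      geometric majorant of ratio \<open>1 / \<rho>\<close>.\<close>
    have "f 0 \<le> f (a k)" "f 0 > 0"
      using a_pos[of k] f_pos[of 0] by (auto intro!: mono_onD[OF f_mono])
    then have "C powr q * \<rho> ^ k * f 0 \<le> C powr q * \<rho> ^ k * f (a k)"
      "0 < C powr q * \<rho> ^ k * f 0"
      using \<rho>_gt1 C_pos by auto
    then have "w k \<le> 1 / (C powr q * \<rho> ^ k * f 0)"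
      unfolding w_def a_powr by (simp only: frac_le zero_le_one order_refl)
    then show "norm (w k) \<le> 1 / (C powr q * f 0) * (1 / \<rho>) ^ k"
      using w_pos[of k] by (simp add: power_divide mult_ac)
  qed
  define W where "W = suminf w"
  have W_pos: "W > 0" unfolding W_def by (rule suminf_pos[OF w_summable w_pos])
  define K where "K = embed_pmf (\<lambda>k. w k / W)"
  have pmf_K: "pmf K k = w k / W" for k
    unfolding K_def
  proof (rule pmf_embed_pmf)
    have "(\<integral>\<^sup>+k. ennreal (w k / W) \<partial>count_space UNIV) = ennreal (\<Sum>k. w k / W)"
      unfolding nn_integral_count_space_nat
      using w_pos W_pos w_summable by (intro suminf_ennreal2 summable_divide) (simp add: less_imp_le)
    then show "(\<integral>\<^sup>+k. ennreal (w k / W) \<partial>count_space UNIV) = 1"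
      using suminf_divide[OF w_summable, of W] W_pos by (simp flip: W_def)
  qed (use w_pos W_pos in \<open>simp add: less_imp_le\<close>)

  \<comment> \<open>Law of the paths, martingale property and moments\<close>
  define Q where "Q k = pmf_of_set (sign_cube (B k) (a k))" for k
  define P where "P = bind_pmf K Q"
  have fin_B: "finite (B k)" for k by (simp add: B_def)
  have B_unique: "\<exists>k0. \<forall>k. n \<in> B k \<longrightarrow> k = k0" for n
  proof -
    have "k \<le> l" if "n \<in> B k" "n \<in> B l" for k l
    proof -
      have "(4 :: nat) ^ k < 4 ^ Suc l" using that unfolding B_def by simp
      then have "k < Suc l" by (rule power_less_imp_less_exp[rotated]) simp
      then show ?thesis by simp
    qed
    then show ?thesis by (metis order.antisym)
  qed
  have coordinate_bound: "\<exists>k. (\<integral>\<^sup>+\<omega>. g (\<omega> n) \<partial>P) \<le> g (a k) * ennreal (pmf K k)"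
    if "g 0 = 0" "\<And>x. g (- x) = g x" for g :: "real \<Rightarrow> ennreal" and n
    using B_unique[of n] that fin_B unfolding P_def Q_def
    by (blast intro: nn_integral_coordinate_sign_cube_mixture)
  have mds: "martingale_difference_sequence (measure_pmf P) (\<lambda>n \<omega>. \<omega> n)"
  proof (rule martingale_difference_sequence_flip_invariant)
    fix n
    show "map_pmf (flip n) P = P"
      unfolding P_def Q_def map_bind_pmf using fin_B by (simp add: map_pmf_flip_sign_cube)
    obtain k where "(\<integral>\<^sup>+\<omega>. ennreal \<bar>\<omega> n\<bar> \<partial>P) \<le> ennreal \<bar>a k\<bar> * ennreal (pmf K k)"
      using coordinate_bound[of "\<lambda>x. ennreal \<bar>x\<bar>" n] by auto
    also have "\<dots> < \<infinity>" by (simp add: ennreal_mult_less_top)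
    finally show "integrable P (\<lambda>\<omega>. \<omega> n)"
      by (intro integrableI_bounded) auto
  qed
  have moment: "(\<integral>\<^sup>+\<omega>. ennreal (\<bar>\<omega> n\<bar> powr q * f \<bar>\<omega> n\<bar>) \<partial>P) \<le> ennreal (1 / W)" for n
  proof -
    obtain k where "(\<integral>\<^sup>+\<omega>. ennreal (\<bar>\<omega> n\<bar> powr q * f \<bar>\<omega> n\<bar>) \<partial>P)
        \<le> ennreal (\<bar>a k\<bar> powr q * f \<bar>a k\<bar>) * ennreal (pmf K k)"
      using coordinate_bound[of "\<lambda>x. ennreal (\<bar>x\<bar> powr q * f \<bar>x\<bar>)" n] by auto
    also have "\<dots> = ennreal (a k powr q * f (a k) * pmf K k)"
      using a_pos[of k] fa_pos[of k] by (simp add: ennreal_mult')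
    \<comment> \<open>The weight \<open>w k\<close> is the reciprocal of the moment at height
      \<open>a k\<close>, so every level gives the same value.\<close>
    also have "a k powr q * f (a k) * pmf K k = 1 / W"
      using a_pos[of k] fa_pos[of k] by (simp add: pmf_K w_def)
    finally show ?thesis .
  qed

  \<comment> \<open>Large partial sums on a single level\<close>
  have tail: "pmf K k / 6 \<le> \<P>(\<omega> in P. \<bar>\<Sum>i=1..N. \<omega> i\<bar> > real N powr (1 / r))"
    if N: "2 * 4 ^ k < N" "N \<le> 4 ^ Suc k" for k N
  proof -
    \<comment> \<open>\<open>D\<close> holds the indices up to \<open>N\<close> that are active on
      level \<open>k\<close>; since \<open>N\<close> exceeds twice \<open>4 ^ k\<close>, there are
      at least \<open>4 ^ k\<close> of them.\<close>
    define D where "D = {4 ^ k<..N}"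
    have D: "D \<subseteq> B k" "D \<noteq> {}" and card_D: "4 ^ k \<le> card D"
      using N by (auto simp: D_def B_def)
    have sum_D: "(\<Sum>i=1..N. \<omega> i) = (\<Sum>i\<in>D. \<omega> i)" if "\<omega> \<in> sign_cube (B k) (a k)" for \<omega>
    proof (rule sum.mono_neutral_right)
      show "\<forall>i\<in>{1..N} - D. \<omega> i = 0"
      proof
        fix i assume "i \<in> {1..N} - D"
        then have "i \<notin> B k" by (auto simp: D_def B_def)
        then show "\<omega> i = 0" using that unfolding sign_cube_def PiE_dflt_def by blast
      qed
    qed (auto simp: D_def)
    have "(real N powr (1 / r))\<^sup>2 = real N powr (2 / r)"
      using N by (simp add: powr_powr flip: powr_realpow)
    also have "\<dots> \<le> (4 ^ Suc k) powr (2 / r)"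
    proof (rule powr_mono2)
      show "real N \<le> 4 ^ Suc k" using of_nat_mono[OF N(2), where 'a = real] by simp
    qed (use r in auto)
    also have "\<dots> = 4 ^ k * (a k)\<^sup>2 / 4"
    proof -
      have "(4 :: real) ^ Suc k = 4 powr real (Suc k)"
        by (rule powr_realpow[symmetric]) simp
      then have "(4 ^ Suc k) powr (2 / r) = (4 :: real) powr (real (Suc k) * (2 / r))"
        by (simp only: powr_powr)
      \<comment> \<open>The exponent is split into one \<open>k\<close> for the number of signs and
        twice the exponent of \<open>a k / 2\<close>.\<close>
      also have "real (Suc k) * (2 / r)
          = real k + (1 / r + (1 / r - 1 / 2) * k + (1 / r + (1 / r - 1 / 2) * k))"
        by (simp add: algebra_simps add_divide_distrib)
      also have "4 powr \<dots> = 4 ^ k * (4 powr (1 / r) * \<sigma> ^ k)\<^sup>2"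
        unfolding \<sigma>_pow power2_eq_square powr_add by (simp add: powr_realpow)
      finally show ?thesis by (simp add: a_def C_def power_mult_distrib)
    qed
    also have "\<dots> \<le> card D * (a k)\<^sup>2 / 4"
    proof -
      have "4 ^ k \<le> real (card D)" using of_nat_mono[OF card_D, where 'a = real] by simp
      then show ?thesis by (intro divide_right_mono mult_right_mono) auto
    qed
    finally have N_le: "(real N powr (1 / r))\<^sup>2 \<le> card D * (a k)\<^sup>2 / 4" .
    have "1 / 6 \<le> measure (measure_pmf (Q k)) {\<omega>. (\<Sum>i\<in>D. \<omega> i)\<^sup>2 > real (card D) * (a k)\<^sup>2 / 4}"
      unfolding Q_def using a_pos[of k] by (intro sign_cube_anticoncentration fin_B D) auto
    also have "\<dots> \<le> measure (measure_pmf (Q k)) {\<omega>. \<bar>\<Sum>i=1..N. \<omega> i\<bar> > real N powr (1 / r)}"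
    proof (rule measure_pmf.finite_measure_mono_AE)
      show "AE \<omega> in Q k. \<omega> \<in> {\<omega>. (\<Sum>i\<in>D. \<omega> i)\<^sup>2 > real (card D) * (a k)\<^sup>2 / 4} \<longrightarrow>
          \<omega> \<in> {\<omega>. \<bar>\<Sum>i=1..N. \<omega> i\<bar> > real N powr (1 / r)}"
      proof (rule AE_pmfI, intro impI)
        fix \<omega> assume "\<omega> \<in> set_pmf (Q k)"
          and large: "\<omega> \<in> {\<omega>. (\<Sum>i\<in>D. \<omega> i)\<^sup>2 > real (card D) * (a k)\<^sup>2 / 4}"
        then have "\<omega> \<in> sign_cube (B k) (a k)"
          by (simp add: Q_def sign_cube_nonempty finite_sign_cube fin_B)
        then have "(real N powr (1 / r))\<^sup>2 < \<bar>\<Sum>i=1..N. \<omega> i\<bar>\<^sup>2"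
          unfolding power2_abs by (subst sum_D) (use large N_le in auto)
        then have "real N powr (1 / r) < \<bar>\<Sum>i=1..N. \<omega> i\<bar>"
          by (rule power2_less_imp_less) simp
        then show "\<omega> \<in> {\<omega>. \<bar>\<Sum>i=1..N. \<omega> i\<bar> > real N powr (1 / r)}"
          by simp
      qed
    qed simp
    finally have "pmf K k * (1 / 6)
        \<le> pmf K k * measure (measure_pmf (Q k)) {\<omega>. \<bar>\<Sum>i=1..N. \<omega> i\<bar> > real N powr (1 / r)}"
      by (intro mult_left_mono) auto
    also have "\<dots> \<le> measure P {\<omega>. \<bar>\<Sum>i=1..N. \<omega> i\<bar> > real N powr (1 / r)}"
      unfolding P_def by (rule pmf_mult_measure_le_measure_bind_pmf)
    finally show ?thesis by simp
  qed

  \<comment> \<open>Divergence of the series\<close>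
  define t where "t n = real (Suc n) powr (p / r - 2) *
    \<P>(\<omega> in P. \<bar>\<Sum>i=1..Suc n. \<omega> i\<bar> > real (Suc n) powr (1 / r))" for n
  have t_nonneg: "t n \<ge> 0" for n by (simp add: t_def)
  \<comment> \<open>The exponent p/r - 2 may have either sign. Between \<open>4 ^ k\<close> and
    \<open>4 * 4 ^ k\<close> the power is at least \<open>c\<close> times its value at
    \<open>4 ^ k\<close> in both cases.\<close>
  define c where "c = min 1 (4 powr (p / r - 2))"
  \<comment> \<open>The block has \<open>2 * 4 ^ k\<close> terms, each carrying the 1/6 of the tail
    bound, whence the 3; \<open>W\<close> and \<open>C powr q\<close> come from
    \<open>pmf K k\<close>.\<close>
  define d where "d = c / (3 * W * C powr q)"
  have c_pos: "c > 0" by (simp add: c_def)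
  have d_pos: "d > 0" using c_pos W_pos C_pos by (simp add: d_def)
  \<comment> \<open>As \<open>t n\<close> concerns the partial sum of length \<open>Suc n\<close>,
    this index range is exactly that of the lengths allowed in \<open>tail\<close>.\<close>
  have block: "d * (1 / f (a k)) \<le> sum t {2 * 4 ^ k..<4 ^ Suc k}" for k
  proof -
    have "c * (4 ^ k) powr (p / r - 2) * (pmf K k / 6) \<le> t n" if n: "n \<in> {2 * 4 ^ k..<4 ^ Suc k}" for n
    proof -
      have n': "4 ^ k \<le> real (Suc n)" "real (Suc n) \<le> 4 * 4 ^ k"
      proof -
        have "4 ^ k \<le> Suc n" "Suc n \<le> 4 * 4 ^ k" using n by auto
        then have "real (4 ^ k) \<le> real (Suc n)" "real (Suc n) \<le> real (4 * 4 ^ k)"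
          by (simp_all only: of_nat_le_iff)
        then show "4 ^ k \<le> real (Suc n)" "real (Suc n) \<le> 4 * 4 ^ k"
          by simp_all
      qed
      have "c * (4 ^ k) powr (p / r - 2) \<le> real (Suc n) powr (p / r - 2)"
      proof (cases "p / r - 2 \<ge> 0")
        case True
        have "c * (4 ^ k) powr (p / r - 2) \<le> 1 * (4 ^ k) powr (p / r - 2)"
          by (intro mult_right_mono) (auto simp: c_def)
        also have "\<dots> \<le> real (Suc n) powr (p / r - 2)"
          using True n' by (simp add: powr_mono2)
        finally show ?thesis .
      next
        case False
        have "c * (4 ^ k) powr (p / r - 2) \<le> 4 powr (p / r - 2) * (4 ^ k) powr (p / r - 2)"
          by (intro mult_right_mono) (auto simp: c_def)
        also have "\<dots> = (4 * 4 ^ k) powr (p / r - 2)"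
          by (simp add: powr_mult)
        also have "\<dots> \<le> real (Suc n) powr (p / r - 2)"
          using False n' by (intro powr_mono2') auto
        finally show ?thesis .
      qed
      then show ?thesis
        unfolding t_def using n tail[of k "Suc n"] c_pos by (intro mult_mono) auto
    qed
    then have "real (card {2 * 4 ^ k..<(4 :: nat) ^ Suc k}) * (c * (4 ^ k) powr (p / r - 2) * (pmf K k / 6))
        \<le> sum t {2 * 4 ^ k..<4 ^ Suc k}"
      by (rule sum_bounded_below)
    moreover have "card {2 * 4 ^ k..<(4 :: nat) ^ Suc k} = 2 * 4 ^ k"
      by simp
    moreover have "4 ^ k * (4 ^ k) powr (p / r - 2) = \<rho> ^ k"
    proof -
      have "\<rho> ^ k = 4 powr (k + k * (p / r - 2))"
        by (simp add: \<rho>_def powr_powr algebra_simps flip: powr_realpow)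
      also have "\<dots> = 4 ^ k * (4 ^ k) powr (p / r - 2)"
        by (simp add: powr_add powr_powr flip: powr_realpow)
      finally show ?thesis by simp
    qed
    ultimately have "c / 3 * \<rho> ^ k * pmf K k \<le> sum t {2 * 4 ^ k..<4 ^ Suc k}"
      by (simp add: mult_ac)
    moreover have "c / 3 * \<rho> ^ k * pmf K k = d * (1 / f (a k))"
      using \<rho>_gt1 by (simp add: pmf_K w_def a_powr d_def)
    ultimately show ?thesis by (simp only:)
  qed
  have "(\<Sum>n. ennreal (t n)) = \<infinity>"
  proof (rule ccontr)
    assume "(\<Sum>n. ennreal (t n)) \<noteq> \<infinity>"
    then have t_summable: "summable t"
      using t_nonneg by (intro summable_suminf_not_top) auto
    \<comment> \<open>The blocks are disjoint, and the nonnegative terms in the gaps between them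
      are dropped.\<close>
    have partial: "d * (\<Sum>k<m. 1 / f (a k)) \<le> sum t {..<4 ^ m}" for m
    proof (induction m)
      case 0
      then show ?case using t_nonneg by (simp add: sum_nonneg)
    next
      case (Suc m)
      have "d * (\<Sum>k<Suc m. 1 / f (a k)) \<le> sum t {..<4 ^ m} + sum t {2 * 4 ^ m..<4 ^ Suc m}"
        using Suc block[of m] by (simp add: algebra_simps)
      also have "\<dots> = sum t ({..<4 ^ m} \<union> {2 * 4 ^ m..<4 ^ Suc m})"
        by (rule sum.union_disjoint[symmetric]) auto
      also have "\<dots> \<le> sum t {..<4 ^ Suc m}"
        using t_nonneg by (intro sum_mono2) (auto intro: less_le_trans)
      finally show ?case .
    qed
    have "summable (\<lambda>k. 1 / f (a k))"
    proof (rule summableI_nonneg_bounded)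
      fix m
      have "d * (\<Sum>k<m. 1 / f (a k)) \<le> suminf t"
        using partial[of m] sum_le_suminf[OF t_summable, of "{..<4 ^ m}"] t_nonneg by simp
      then show "(\<Sum>k<m. 1 / f (a k)) \<le> suminf t / d"
        using d_pos by (simp add: pos_le_divide_eq mult.commute)
    qed (use fa_pos in \<open>simp add: less_imp_le\<close>)
    then show False
      using not_summable_inverse_geometric[OF f_pos f_mono f_div C_pos \<sigma>_pos]
      unfolding a_def by blast
  qed
  moreover have "(SUP n\<in>{1..}. \<integral>\<^sup>+\<omega>. ennreal (\<bar>\<omega> n\<bar> powr q * f \<bar>\<omega> n\<bar>) \<partial>P) < \<infinity>"
  proof -
    have "(SUP n\<in>{1..}. \<integral>\<^sup>+\<omega>. ennreal (\<bar>\<omega> n\<bar> powr q * f \<bar>\<omega> n\<bar>) \<partial>P) \<le> ennreal (1 / W)"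
      by (rule SUP_least) (rule moment)
    also have "\<dots> < \<infinity>" by simp
    finally show ?thesis .
  qed
  ultimately show ?thesis
    using mds measure_pmf.prob_space_axioms[of P] unfolding t_def
    by (intro exI[of _ "measure_pmf P"] exI[of _ "\<lambda>n \<omega>. \<omega> n"] conjI)
qed

end
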